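(* Let $\mathcal{A}\otimes\mathcal{C}$, $\epsilon$ and the elements $O_i,O_{ij},O_{ijk}$ be as defined in the context. Then for all $i,j,k,l\in\{1,\dots,N\}$, $$[O_{ij},O_{kl}]=(O_{il}+\epsilon[O_i,O_l])\delta_{jk}+(O_{jk}+\epsilon[O_j,O_k])\delta_{il}+(O_{ki}+\epsilon[O_k,O_i])\delta_{lj}+(O_{lj}+\epsilon[O_l,O_j])\delta_{ki}$$ $$\qquad+\tfrac12\big(\{O_i,O_{jkl}\}-\{O_j,O_{ikl}\}-\{O_{ijl},O_k\}+\{O_{ijk},O_l\}\big).$$
   Context: Let $\mathbb{K}$ be $\mathbb{R}$ or $\mathbb{C}$ and $N\ge1$. $\mathcal{A}$ is the unital associative $\mathbb{K}$-algebra generated by $x_1,\dots,x_N,p_1,\dots,p_N$ subject to the relations, for all $i,j$, $$[x_i,x_j]=0,\quad [p_i,p_j]=0,\quad \Big[\tfrac12\sum_{i=1}^N p_i^2,\,x_j\Big]=p_j,\quad \Big[\tfrac12\sum_{i=1}^N x_i^2,\,p_j\Big]=-x_j,$$ where $[a,b]=ab-ba$, $\{a,b\}=ab+ba$. Fix $\epsilon\in\{+1,-1\}$. $\mathcal{C}$ is the Clifford algebra over $\mathbb{K}$ generated by $e_1,\dots,e_N$ with $e_ie_j+e_je_i=2\epsilon\delta_{ij}$. In $\mathcal{A}\otimes\mathcal{C}$ the tensor sign is omitted, and the $e_i$ commute with all $x_j,p_j$. Put $\underline{D}=\sum_{i=1}^N e_ip_i$. A list is a finite sequence $A=a_1\cdots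 a_n$ of distinct elements of $\{1,\dots,N\}$; $e_A=e_{a_1}\cdots e_{a_n}$ and $\underline{x}_A=\sum_{a\in A}x_ae_a$. For a list $A$ define $$O_A=\tfrac12\big(\underline{D}\,\underline{x}_Ae_A-e_A\underline{x}_A\underline{D}-\epsilon e_A\big).$$ $O_i$, $O_{ij}$, $O_{ijk}$ denote $O_A$ for the lists $A=i$, $A=ij$, $A=ijk$ respectively. $O_A$ changes by the sign of the permutation when the entries of $A$ are permuted; accordingly, $O_{ij}$ and $O_{ijk}$ are understood to be $0$ whenever two of their indices coincide. *)

theory Defs
  imports Complex_Main "HOL-Library.Poly_Mapping" "HOL-Algebra.Module" "HOL-Algebra.QuotRing"
begin

section \<open>The ground field\<close>

text \<open>The fields that are (isomorphic to) the real or the complex numbers.\<close>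

class real_or_complex = field +
  assumes real_or_complex:
    "(\<exists>h :: 'a \<Rightarrow> real. bij h \<and>
        (\<forall>a b. h (a + b) = h a + h b) \<and> (\<forall>a b. h (a * b) = h a * h b)) \<or>
     (\<exists>h :: 'a \<Rightarrow> complex. bij h \<and>
        (\<forall>a b. h (a + b) = h a + h b) \<and> (\<forall>a b. h (a * b) = h a * h b))"

instance real :: real_or_complex
  by standard (rule disjI1, rule exI[of _ id], simp)

instance complex :: real_or_complex
  by standard (rule disjI2, rule exI[of _ id], simp)


section \<open>Associative algebras\<close>

text \<open>
  The record type \<open>module\<close> extends rings by a scalar multiplication; it is used here for
  unital associative algebras that need not be commutative (the locale \<^locale>\<open>algebra\<close> of
  HOL-Algebra requires commutativity). The scalars are all elements of the type \<open>'k\<close>.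
\<close>

text \<open>
  The monoid algebra: finite formal linear combinations of elements of \<open>M\<close>, multiplied
  bilinearly.
\<close>

definition monoid_algebra :: "('m, 'z) monoid_scheme \<Rightarrow> ('k::field, 'm \<Rightarrow>\<^sub>0 'k) module" where
  "monoid_algebra M =
    \<lparr>carrier = {f. Poly_Mapping.keys f \<subseteq> carrier M},
     mult = (\<lambda>f g. \<Sum>a\<in>Poly_Mapping.keys f. \<Sum>b\<in>Poly_Mapping.keys g.
        Poly_Mapping.single (a \<otimes>\<^bsub>M\<^esub> b) (Poly_Mapping.lookup f a * Poly_Mapping.lookup g b)),
     one = Poly_Mapping.single \<one>\<^bsub>M\<^esub> 1,
     zero = 0,
     add = (+),
     smult = (\<lambda>c. Poly_Mapping.map ((*) c))\<rparr>"

definition quotient_algebra :: "('k, 'a, 'z) module_scheme \<Rightarrow> 'a set \<Rightarrow> ('k, 'a set) module" where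
  "quotient_algebra R I =
    \<lparr>carrier = carrier (R Quot I),
     mult = mult (R Quot I),
     one = one (R Quot I),
     zero = zero (R Quot I),
     add = add (R Quot I),
     smult = (\<lambda>c U. \<Union>u\<in>U. I +>\<^bsub>R\<^esub> (c \<odot>\<^bsub>R\<^esub> u))\<rparr>"

text \<open>The free algebra on all elements of the type \<open>'g\<close> is the monoid algebra of words.\<close>

definition free_algebra :: "('k::field, 'g list \<Rightarrow>\<^sub>0 'k) module" where
  "free_algebra = monoid_algebra \<lparr>carrier = UNIV, mult = (@), one = []\<rparr>"

definition free_gen :: "'g \<Rightarrow> 'g list \<Rightarrow>\<^sub>0 'k::field" where
  "free_gen g = Poly_Mapping.single [g] 1"

definition presented_algebra ::
    "('g list \<Rightarrow>\<^sub>0 'k::field) set \<Rightarrow> ('k, ('g list \<Rightarrow>\<^sub>0 'k) set) module" where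
  "presented_algebra Rel = quotient_algebra free_algebra (Idl\<^bsub>free_algebra\<^esub> Rel)"

definition presented_gen ::
    "('g list \<Rightarrow>\<^sub>0 'k::field) set \<Rightarrow> 'g \<Rightarrow> ('g list \<Rightarrow>\<^sub>0 'k) set" where
  "presented_gen Rel g = (Idl\<^bsub>free_algebra\<^esub> Rel) +>\<^bsub>free_algebra\<^esub> free_gen g"

text \<open>
  The tensor product of algebras \<open>R\<close> and \<open>S\<close>: the free vector space on the pairs
  \<open>(a, b)\<close>, modulo the bilinearity relations. The componentwise product of pairs makes the
  free vector space the monoid algebra of \<open>R \<times>\<times> S\<close>; the linear span of the bilinearity
  relators is a two-sided ideal of it, hence coincides with the ideal they generate.
\<close>

definition bilinear_relators ::
    "('k::field, 'a, 'y) module_scheme \<Rightarrow> ('k, 'b, 'z) module_scheme \<Rightarrow> ('a \<times> 'b \<Rightarrow>\<^sub>0 'k) set" where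
  "bilinear_relators R S =
    (let t = (\<lambda>a b. Poly_Mapping.single (a, b) 1) in
      {t (a \<oplus>\<^bsub>R\<^esub> a') b - t a b - t a' b | a a' b.
         a \<in> carrier R \<and> a' \<in> carrier R \<and> b \<in> carrier S} \<union>
      {t a (b \<oplus>\<^bsub>S\<^esub> b') - t a b - t a b' | a b b'.
         a \<in> carrier R \<and> b \<in> carrier S \<and> b' \<in> carrier S} \<union>
      {t (c \<odot>\<^bsub>R\<^esub> a) b - Poly_Mapping.single (a, b) c | c a b.
         a \<in> carrier R \<and> b \<in> carrier S} \<union>
      {t a (c \<odot>\<^bsub>S\<^esub> b) - Poly_Mapping.single (a, b) c | c a b.
         a \<in> carrier R \<and> b \<in> carrier S})"

definition tensor_algebra ::
    "('k::field, 'a, 'y) module_scheme \<Rightarrow> ('k, 'b, 'z) module_scheme \<Rightarrow>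
     ('k, ('a \<times> 'b \<Rightarrow>\<^sub>0 'k) set) module" where
  "tensor_algebra R S =
    quotient_algebra (monoid_algebra (R \<times>\<times> S))
      (Idl\<^bsub>monoid_algebra (R \<times>\<times> S)\<^esub> (bilinear_relators R S))"

definition pure_tensor ::
    "('k::field, 'a, 'y) module_scheme \<Rightarrow> ('k, 'b, 'z) module_scheme \<Rightarrow>
     'a \<Rightarrow> 'b \<Rightarrow> ('a \<times> 'b \<Rightarrow>\<^sub>0 'k) set" where
  "pure_tensor R S a b =
    (Idl\<^bsub>monoid_algebra (R \<times>\<times> S)\<^esub> (bilinear_relators R S))
      +>\<^bsub>monoid_algebra (R \<times>\<times> S)\<^esub> Poly_Mapping.single (a, b) 1"

definition commutator :: "('a, 'z) ring_scheme \<Rightarrow> 'a \<Rightarrow> 'a \<Rightarrow> 'a" where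
  "commutator R a b = a \<otimes>\<^bsub>R\<^esub> b \<ominus>\<^bsub>R\<^esub> b \<otimes>\<^bsub>R\<^esub> a"

definition anticommutator :: "('a, 'z) ring_scheme \<Rightarrow> 'a \<Rightarrow> 'a \<Rightarrow> 'a" where
  "anticommutator R a b = a \<otimes>\<^bsub>R\<^esub> b \<oplus>\<^bsub>R\<^esub> b \<otimes>\<^bsub>R\<^esub> a"


section \<open>The algebras \<open>\<A>\<close>, \<open>\<C>\<close> and their tensor product\<close>

text \<open>
  The index set \<open>{1,\<dots>,N}\<close> is the universe of a finite type \<open>'n\<close>, so \<open>N = CARD('n) \<ge> 1\<close>.
\<close>

datatype 'n xp_gen = X 'n | P 'n

definition A_relators :: "('n::finite xp_gen list \<Rightarrow>\<^sub>0 'k::field) set" where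
  "A_relators =
    (let F = free_algebra; x = (\<lambda>i. free_gen (X i)); p = (\<lambda>i. free_gen (P i)) in
      (\<Union>i j.
        {commutator F (x i) (x j),
         commutator F (p i) (p j),
         commutator F ((1/2) \<odot>\<^bsub>F\<^esub> (\<Oplus>\<^bsub>F\<^esub>i\<in>UNIV. p i \<otimes>\<^bsub>F\<^esub> p i)) (x j) \<ominus>\<^bsub>F\<^esub> p j,
         commutator F ((1/2) \<odot>\<^bsub>F\<^esub> (\<Oplus>\<^bsub>F\<^esub>i\<in>UNIV. x i \<otimes>\<^bsub>F\<^esub> x i)) (p j) \<oplus>\<^bsub>F\<^esub> x j}))"

definition A_alg :: "('k::field, ('n::finite xp_gen list \<Rightarrow>\<^sub>0 'k) set) module" where
  "A_alg = presented_algebra A_relators"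

definition C_relators :: "'k::field \<Rightarrow> ('n::finite list \<Rightarrow>\<^sub>0 'k) set" where
  "C_relators \<epsilon> =
    (let F = free_algebra in
      (\<Union>i j. {anticommutator F (free_gen i) (free_gen j)
                \<ominus>\<^bsub>F\<^esub> (2 * \<epsilon> * of_bool (i = j)) \<odot>\<^bsub>F\<^esub> \<one>\<^bsub>F\<^esub>}))"

definition C_alg :: "'k::field \<Rightarrow> ('k, ('n::finite list \<Rightarrow>\<^sub>0 'k) set) module" where
  "C_alg \<epsilon> = presented_algebra (C_relators \<epsilon>)"

type_synonym ('k, 'n) AC =
  "(('n xp_gen list \<Rightarrow>\<^sub>0 'k) set \<times> ('n list \<Rightarrow>\<^sub>0 'k) set \<Rightarrow>\<^sub>0 'k) set"

definition AC_alg :: "'k::field \<Rightarrow> ('k, ('k, 'n::finite) AC) module" where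
  "AC_alg \<epsilon> = tensor_algebra A_alg (C_alg \<epsilon>)"

definition x_el :: "'k::field \<Rightarrow> 'n::finite \<Rightarrow> ('k, 'n) AC" where
  "x_el \<epsilon> i = pure_tensor A_alg (C_alg \<epsilon>) (presented_gen A_relators (X i)) \<one>\<^bsub>C_alg \<epsilon>\<^esub>"

definition p_el :: "'k::field \<Rightarrow> 'n::finite \<Rightarrow> ('k, 'n) AC" where
  "p_el \<epsilon> i = pure_tensor A_alg (C_alg \<epsilon>) (presented_gen A_relators (P i)) \<one>\<^bsub>C_alg \<epsilon>\<^esub>"

definition e_el :: "'k::field \<Rightarrow> 'n::finite \<Rightarrow> ('k, 'n) AC" where
  "e_el \<epsilon> i = pure_tensor A_alg (C_alg \<epsilon>) \<one>\<^bsub>A_alg\<^esub> (presented_gen (C_relators \<epsilon>) i)"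

definition D_el :: "'k::field \<Rightarrow> ('k, 'n::finite) AC" where
  "D_el \<epsilon> = (\<Oplus>\<^bsub>AC_alg \<epsilon>\<^esub>i\<in>UNIV. e_el \<epsilon> i \<otimes>\<^bsub>AC_alg \<epsilon>\<^esub> p_el \<epsilon> i)"

definition e_list :: "'k::field \<Rightarrow> 'n::finite list \<Rightarrow> ('k, 'n) AC" where
  "e_list \<epsilon> A = foldr (mult (AC_alg \<epsilon>)) (map (e_el \<epsilon>) A) \<one>\<^bsub>AC_alg \<epsilon>\<^esub>"

definition x_list :: "'k::field \<Rightarrow> 'n::finite list \<Rightarrow> ('k, 'n) AC" where
  "x_list \<epsilon> A = (\<Oplus>\<^bsub>AC_alg \<epsilon>\<^esub>a\<in>set A. x_el \<epsilon> a \<otimes>\<^bsub>AC_alg \<epsilon>\<^esub> e_el \<epsilon> a)"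

text \<open>By convention \<open>O\<^sub>A = 0\<close> when the entries of \<open>A\<close> are not distinct.\<close>

definition O_el :: "'k::field \<Rightarrow> 'n::finite list \<Rightarrow> ('k, 'n) AC" where
  "O_el \<epsilon> A =
    (let T = AC_alg \<epsilon> in
      if distinct A then
        (1/2) \<odot>\<^bsub>T\<^esub>
          (D_el \<epsilon> \<otimes>\<^bsub>T\<^esub> x_list \<epsilon> A \<otimes>\<^bsub>T\<^esub> e_list \<epsilon> A
           \<ominus>\<^bsub>T\<^esub> e_list \<epsilon> A \<otimes>\<^bsub>T\<^esub> x_list \<epsilon> A \<otimes>\<^bsub>T\<^esub> D_el \<epsilon>
           \<ominus>\<^bsub>T\<^esub> \<epsilon> \<odot>\<^bsub>T\<^esub> e_list \<epsilon> A)
      else \<zero>\<^bsub>T\<^esub>)"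

end

theory Submission
  imports Defs
begin

text \<open>
  Put \<open>C\<^sub>i\<^sub>j = [p\<^sub>i, x\<^sub>j]\<close>. Since \<open>p\<^sub>i = [H, x\<^sub>i]\<close> with \<open>H = 1/2 \<Sum> p\<^sub>k\<^sup>2\<close> and the \<open>x\<^sub>i\<close> commute, \<open>C\<^sub>i\<^sub>j\<close>
  is symmetric, and so are \<open>[O\<^sub>i, x\<^sub>j]\<close> and \<open>[O\<^sub>i, p\<^sub>j]\<close>; moreover \<open>{O\<^sub>i, e\<^sub>j} = C\<^sub>i\<^sub>j - \<delta>\<^sub>i\<^sub>j\<close>. With
  \<open>L\<^sub>i\<^sub>j = x\<^sub>i p\<^sub>j - x\<^sub>j p\<^sub>i\<close> one finds, for distinct indices,
  \<open>O\<^sub>i\<^sub>j = L\<^sub>i\<^sub>j + O\<^sub>i e\<^sub>j - O\<^sub>j e\<^sub>i + \<epsilon>/2 e\<^sub>i e\<^sub>j\<close>, and \<open>O\<^sub>i\<^sub>j\<^sub>k\<close> is the cyclic sum of \<open>O\<^sub>i e\<^sub>j e\<^sub>k + L\<^sub>i\<^sub>j e\<^sub>k\<close>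
  plus \<open>\<epsilon> e\<^sub>i e\<^sub>j e\<^sub>k\<close>. Ordering all words as \<open>x < O, C < p < e\<close> by these relations reduces both
  sides to the same normal form when the indices are distinct or when exactly two of them agree;
  antisymmetry of \<open>O\<^sub>A\<close> yields the remaining cases.

  To compute with a type class instead of a carrier, the algebras for \<open>\<epsilon> = 1\<close> and \<open>\<epsilon> = -1\<close> are
  combined into a type, their product, in which \<open>\<epsilon>\<close> becomes a central element of square one.
\<close>

section \<open>Unital associative algebras\<close>

locale assoc_algebra = ring R for R :: "('k::field, 'a, 'z) module_scheme" (structure) +
  assumes smult_closed [simp, intro]: "a \<in> carrier R \<Longrightarrow> c \<odot> a \<in> carrier R"
    and smult_l_distr: "a \<in> carrier R \<Longrightarrow> (c + d) \<odot> a = c \<odot> a \<oplus> d \<odot> a"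
    and smult_r_distr: "\<lbrakk>a \<in> carrier R; b \<in> carrier R\<rbrakk> \<Longrightarrow> c \<odot> (a \<oplus> b) = c \<odot> a \<oplus> c \<odot> b"
    and smult_assoc1: "a \<in> carrier R \<Longrightarrow> (c * d) \<odot> a = c \<odot> (d \<odot> a)"
    and smult_one [simp]: "a \<in> carrier R \<Longrightarrow> 1 \<odot> a = a"
    and smult_mult_left: "\<lbrakk>a \<in> carrier R; b \<in> carrier R\<rbrakk> \<Longrightarrow> (c \<odot> a) \<otimes> b = c \<odot> (a \<otimes> b)"
    and smult_mult_right: "\<lbrakk>a \<in> carrier R; b \<in> carrier R\<rbrakk> \<Longrightarrow> a \<otimes> (c \<odot> b) = c \<odot> (a \<otimes> b)"
begin

text \<open>Scaling is left multiplication by \<open>c \<odot> \<one>\<close>, so a two-sided ideal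
  is closed under scaling; this is what makes scalars well defined on quotients.\<close>

lemma smult_conv_mult: "a \<in> carrier R \<Longrightarrow> c \<odot> a = (c \<odot> \<one>) \<otimes> a"
  by (simp add: smult_mult_left)

lemma minus_eq_zero:
  "\<lbrakk>a \<in> carrier R; b \<in> carrier R\<rbrakk> \<Longrightarrow> a \<ominus> b = \<zero> \<longleftrightarrow> a = b"
  by (metis a_minus_def add.inv_closed minus_equality minus_minus r_neg)

lemma smult_zero_left [simp]: "a \<in> carrier R \<Longrightarrow> 0 \<odot> a = \<zero>"
  using smult_l_distr[of a 0 0] by simp

end

locale assoc_algebra_hom = R: assoc_algebra R + S: assoc_algebra S
  for R :: "('k::field, 'a, 'y) module_scheme" and S :: "('k, 'b, 'z) module_scheme" +
  fixes h
  assumes hom: "h \<in> ring_hom R S"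
    and hom_smult: "a \<in> carrier R \<Longrightarrow> h (c \<odot>\<^bsub>R\<^esub> a) = c \<odot>\<^bsub>S\<^esub> h a"
begin

sublocale ring_hom_ring R S h
  by (rule ring_hom_ringI2) (auto simp: hom R.ring_axioms S.ring_axioms)

lemma hom_minus:
  "\<lbrakk>a \<in> carrier R; b \<in> carrier R\<rbrakk> \<Longrightarrow> h (a \<ominus>\<^bsub>R\<^esub> b) = h a \<ominus>\<^bsub>S\<^esub> h b"
  by (simp add: a_minus_def)

lemma hom_finsum: "f \<in> A \<rightarrow> carrier R \<Longrightarrow> h (finsum R f A) = finsum S (h \<circ> f) A"
  by (induction A rule: infinite_finite_induct) (auto simp: Pi_def)

lemma hom_commutator:
  "\<lbrakk>a \<in> carrier R; b \<in> carrier R\<rbrakk> \<Longrightarrow> h (commutator R a b) = commutator S (h a) (h b)"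
  by (simp add: commutator_def hom_minus)

lemma hom_anticommutator:
  "\<lbrakk>a \<in> carrier R; b \<in> carrier R\<rbrakk> \<Longrightarrow> h (anticommutator R a b) = anticommutator S (h a) (h b)"
  by (simp add: anticommutator_def)

end

lemma assoc_algebra_hom_comp:
  assumes "assoc_algebra_hom R S g" "assoc_algebra_hom S T h"
  shows "assoc_algebra_hom R T (h \<circ> g)"
proof -
  interpret g: assoc_algebra_hom R S g by fact
  interpret h: assoc_algebra_hom S T h by fact
  show ?thesis
    by unfold_locales (auto simp: g.hom_smult h.hom_smult intro!: ring_hom_memI)
qed

subsection \<open>Monoid algebras\<close>

lemma monoid_algebra_simps [simp]:
  "carrier (monoid_algebra M) = {f. Poly_Mapping.keys f \<subseteq> carrier M}"
  "\<one>\<^bsub>monoid_algebra M\<^esub> = Poly_Mapping.single \<one>\<^bsub>M\<^esub> 1"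
  "\<zero>\<^bsub>monoid_algebra M\<^esub> = 0"
  "add (monoid_algebra M) = (+)"
  "c \<odot>\<^bsub>monoid_algebra M\<^esub> f = Poly_Mapping.map ((*) c) f"
  by (simp_all add: monoid_algebra_def)

text \<open>Summing over arbitrary finite supersets of the supports lets products of elements with
  different supports share their index sets, as distributivity requires.\<close>

lemma monoid_algebra_mult:
  assumes "finite A" "finite B" "Poly_Mapping.keys f \<subseteq> A" "Poly_Mapping.keys g \<subseteq> B"
  shows "f \<otimes>\<^bsub>monoid_algebra M\<^esub> g = (\<Sum>a\<in>A. \<Sum>b\<in>B.
    Poly_Mapping.single (a \<otimes>\<^bsub>M\<^esub> b) (Poly_Mapping.lookup f a * Poly_Mapping.lookup g b))"
proof -
  have "f \<otimes>\<^bsub>monoid_algebra M\<^esub> g = (\<Sum>a\<in>Poly_Mapping.keys f. \<Sum>b\<in>B.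
    Poly_Mapping.single (a \<otimes>\<^bsub>M\<^esub> b) (Poly_Mapping.lookup f a * Poly_Mapping.lookup g b))"
    unfolding monoid_algebra_def module.simps monoid.simps using assms
    by (intro sum.cong[OF refl] sum.mono_neutral_left) (auto simp: in_keys_iff)
  also have "\<dots> = (\<Sum>a\<in>A. \<Sum>b\<in>B.
    Poly_Mapping.single (a \<otimes>\<^bsub>M\<^esub> b) (Poly_Mapping.lookup f a * Poly_Mapping.lookup g b))"
    using assms by (intro sum.mono_neutral_left) (auto simp: in_keys_iff)
  finally show ?thesis .
qed

lemma monoid_algebra_mult_single [simp]:
  "Poly_Mapping.single a c \<otimes>\<^bsub>monoid_algebra M\<^esub> Poly_Mapping.single b d =
    Poly_Mapping.single (a \<otimes>\<^bsub>M\<^esub> b) (c * d)"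
  by (subst monoid_algebra_mult[of "{a}" "{b}"]) auto

lemma monoid_algebra_distrib:
  "(f + f') \<otimes>\<^bsub>monoid_algebra M\<^esub> g = f \<otimes>\<^bsub>monoid_algebra M\<^esub> g + f' \<otimes>\<^bsub>monoid_algebra M\<^esub> g"
  "g \<otimes>\<^bsub>monoid_algebra M\<^esub> (f + f') = g \<otimes>\<^bsub>monoid_algebra M\<^esub> f + g \<otimes>\<^bsub>monoid_algebra M\<^esub> f'"
proof -
  let ?A = "Poly_Mapping.keys f \<union> Poly_Mapping.keys f'" and ?B = "Poly_Mapping.keys g"
  have "Poly_Mapping.keys (f + f') \<subseteq> ?A" by (rule Poly_Mapping.keys_add)
  note rule = monoid_algebra_mult[of ?A ?B _ g] monoid_algebra_mult[of ?B ?A g] this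
  show "(f + f') \<otimes>\<^bsub>monoid_algebra M\<^esub> g = f \<otimes>\<^bsub>monoid_algebra M\<^esub> g + f' \<otimes>\<^bsub>monoid_algebra M\<^esub> g"
    by (simp add: rule lookup_add distrib_right single_add sum.distrib)
  show "g \<otimes>\<^bsub>monoid_algebra M\<^esub> (f + f') = g \<otimes>\<^bsub>monoid_algebra M\<^esub> f + g \<otimes>\<^bsub>monoid_algebra M\<^esub> f'"
    by (simp add: rule lookup_add distrib_left single_add sum.distrib)
qed

text \<open>An element is the finite sum of its single terms, so an additive property needs checking
  only on those.\<close>

lemma monoid_algebra_induct [consumes 1, case_names zero single add]:
  fixes f :: "'a \<Rightarrow>\<^sub>0 'b::comm_monoid_add"
  assumes f: "Poly_Mapping.keys f \<subseteq> A"
    and "Q 0" "\<And>a c. a \<in> A \<Longrightarrow> Q (Poly_Mapping.single a c)"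
    and "\<And>f g. \<lbrakk>Q f; Q g\<rbrakk> \<Longrightarrow> Q (f + g)"
  shows "Q f"
proof -
  have "f = (\<Sum>a\<in>Poly_Mapping.keys f. Poly_Mapping.single a (Poly_Mapping.lookup f a))"
    by (rule poly_mapping_eqI) (auto simp: lookup_sum lookup_single when_def in_keys_iff)
  moreover have "Q (\<Sum>a\<in>B. Poly_Mapping.single a (Poly_Mapping.lookup f a))"
    if "finite B" "B \<subseteq> A" for B
    using that by (induction B) (auto intro: assms)
  ultimately show ?thesis using f by (metis finite_keys)
qed

lemma lookup_smult [simp]:
  "Poly_Mapping.lookup (Poly_Mapping.map ((*) c) f) a = (c::'k::field) * Poly_Mapping.lookup f a"
  by (simp add: Poly_Mapping.map.rep_eq when_def)

lemma poly_mapping_smult: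
  fixes f g :: "'a \<Rightarrow>\<^sub>0 'k::field"
  shows "Poly_Mapping.map ((*) c) (f + g) = Poly_Mapping.map ((*) c) f + Poly_Mapping.map ((*) c) g"
    and "Poly_Mapping.map ((*) (c + d)) f = Poly_Mapping.map ((*) c) f + Poly_Mapping.map ((*) d) f"
    and "Poly_Mapping.map ((*) (c * d)) f = Poly_Mapping.map ((*) c) (Poly_Mapping.map ((*) d) f)"
    and "Poly_Mapping.map ((*) 1) f = f"
    and "Poly_Mapping.map ((*) c) (0 :: 'a \<Rightarrow>\<^sub>0 'k) = 0"
  by (rule poly_mapping_eqI; simp add: lookup_add distrib_left distrib_right mult.assoc)+

text \<open>The multiplicative laws are additive in every argument. Induction on the arguments
  reduces them to single terms, where they are laws of the monoid and of the field.\<close>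

lemma assoc_algebra_monoid_algebra:
  assumes "Group.monoid M"
  shows "assoc_algebra (monoid_algebra M :: ('k::field, _) module)"
proof -
  interpret M: Group.monoid M by fact
  let ?R = "monoid_algebra M :: ('k, _) module"
  have zero [simp]: "0 \<otimes>\<^bsub>?R\<^esub> f = 0" "f \<otimes>\<^bsub>?R\<^esub> 0 = 0" for f
    by (simp_all add: monoid_algebra_def)
  have keys_sum: "Poly_Mapping.keys (f + g) \<subseteq> carrier M"
    if "Poly_Mapping.keys f \<subseteq> carrier M" "Poly_Mapping.keys g \<subseteq> carrier M" for f g :: "_ \<Rightarrow>\<^sub>0 'k"
    using that Poly_Mapping.keys_add[of f g] by blast
  have closed: "Poly_Mapping.keys (f \<otimes>\<^bsub>?R\<^esub> g) \<subseteq> carrier M"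
    if f: "Poly_Mapping.keys f \<subseteq> carrier M" and g: "Poly_Mapping.keys g \<subseteq> carrier M" for f g
    using f
  proof (induction rule: monoid_algebra_induct)
    case (single a c)
    from g show ?case
      by (induction rule: monoid_algebra_induct) (auto simp: single keys_sum monoid_algebra_distrib)
  qed (auto simp: monoid_algebra_distrib keys_sum)
  have assoc: "f \<otimes>\<^bsub>?R\<^esub> g \<otimes>\<^bsub>?R\<^esub> h = f \<otimes>\<^bsub>?R\<^esub> (g \<otimes>\<^bsub>?R\<^esub> h)"
    if f: "Poly_Mapping.keys f \<subseteq> carrier M" and g: "Poly_Mapping.keys g \<subseteq> carrier M"
      and h: "Poly_Mapping.keys h \<subseteq> carrier M" for f g h
    using f
  proof (induction rule: monoid_algebra_induct)
    case s1: (single a c)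
    from g show ?case
    proof (induction rule: monoid_algebra_induct)
      case s2: (single b d)
      from h show ?case
        by (induction rule: monoid_algebra_induct)
          (auto simp: s1 s2 M.m_assoc monoid_algebra_distrib mult.assoc)
    qed (auto simp: monoid_algebra_distrib)
  qed (auto simp: monoid_algebra_distrib)
  have one: "Poly_Mapping.single \<one>\<^bsub>M\<^esub> 1 \<otimes>\<^bsub>?R\<^esub> f = f" "f \<otimes>\<^bsub>?R\<^esub> Poly_Mapping.single \<one>\<^bsub>M\<^esub> 1 = f"
    if f: "Poly_Mapping.keys f \<subseteq> carrier M" for f
    using f by (induction rule: monoid_algebra_induct) (auto simp: monoid_algebra_distrib)
  have "ring ?R"
  proof (rule ringI)
    show "abelian_group ?R"
    proof (rule abelian_groupI)
      fix f assume "f \<in> carrier ?R"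
      then have "- f \<in> carrier ?R" by (auto simp: in_keys_iff)
      then show "\<exists>g\<in>carrier ?R. g \<oplus>\<^bsub>?R\<^esub> f = \<zero>\<^bsub>?R\<^esub>"
        by (intro bexI[of _ "- f"]) auto
    qed (auto simp: keys_sum add_ac)
    show "Group.monoid ?R"
      by (rule monoidI) (auto simp: closed assoc one)
  qed (auto simp: monoid_algebra_distrib)
  have smult: "Poly_Mapping.map ((*) c) f \<otimes>\<^bsub>?R\<^esub> g = Poly_Mapping.map ((*) c) (f \<otimes>\<^bsub>?R\<^esub> g) \<and>
      f \<otimes>\<^bsub>?R\<^esub> Poly_Mapping.map ((*) c) g = Poly_Mapping.map ((*) c) (f \<otimes>\<^bsub>?R\<^esub> g)"
    if f: "Poly_Mapping.keys f \<subseteq> carrier M" and g: "Poly_Mapping.keys g \<subseteq> carrier M" for f g c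
    using f
  proof (induction rule: monoid_algebra_induct)
    case s1: (single a d)
    from g show ?case
      by (induction rule: monoid_algebra_induct)
        (auto simp: s1 monoid_algebra_distrib poly_mapping_smult mult.assoc mult.left_commute)
  qed (auto simp: monoid_algebra_distrib poly_mapping_smult)
  have keys: "Poly_Mapping.keys (Poly_Mapping.map ((*) c) f) \<subseteq> Poly_Mapping.keys f"
    for c and f :: "_ \<Rightarrow>\<^sub>0 'k"
    by (auto simp: in_keys_iff)
  show ?thesis
    by (intro assoc_algebra.intro assoc_algebra_axioms.intro \<open>ring ?R\<close>)
      (use keys in \<open>force simp: poly_mapping_smult smult\<close>)+
qed

subsection \<open>Quotients and presentations\<close>

lemma quotient_algebra_simps [simp]:
  "carrier (quotient_algebra R I) = carrier (R Quot I)"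
  "mult (quotient_algebra R I) = mult (R Quot I)"
  "one (quotient_algebra R I) = one (R Quot I)"
  "zero (quotient_algebra R I) = zero (R Quot I)"
  "add (quotient_algebra R I) = add (R Quot I)"
  by (simp_all add: quotient_algebra_def)

lemma (in assoc_algebra) quotient_hom:
  assumes "ideal I R"
  shows "assoc_algebra_hom R (quotient_algebra R I) ((+>) I)"
proof -
  interpret I: ideal I R by fact
  let ?Q = "quotient_algebra R I"
  interpret Q: ring "R Quot I" by (rule I.quotient_is_ring)
  note hom = ring_hom_add[OF I.rcos_ring_hom, symmetric] ring_hom_mult[OF I.rcos_ring_hom, symmetric]
  have carr: "U \<in> carrier (R Quot I) \<longleftrightarrow> (\<exists>u\<in>carrier R. U = I +> u)" for U
    by (auto simp: FactRing_def A_RCOSETS_def')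
  have smult: "c \<odot>\<^bsub>?Q\<^esub> (I +> u) = I +> (c \<odot> u)" if u: "u \<in> carrier R" for c u
  proof -
    \<comment> \<open>The union that defines scaling on the quotient runs over a constant family:
      the class of \<open>c \<odot> u'\<close> does not depend on the representative, because the
      ideal absorbs \<open>c \<odot> \<one>\<close>.\<close>
    have "I +> (c \<odot> u') = I +> (c \<odot> u)" if u': "u' \<in> I +> u" for u'
    proof -
      obtain i where i: "i \<in> I" "u' = i \<oplus> u"
        using u' unfolding a_r_coset_def r_coset_def by auto
      have "(c \<odot> \<one>) \<otimes> i \<in> I" using i by (simp add: I.I_l_closed)
      then have "c \<odot> i \<in> I" using i I.Icarr by (simp add: smult_conv_mult[symmetric])
      moreover have "c \<odot> u' = c \<odot> i \<oplus> c \<odot> u"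
        using i u I.Icarr by (simp add: smult_r_distr)
      moreover have "c \<odot> i \<oplus> c \<odot> u \<ominus> c \<odot> u = c \<odot> i"
        using i u I.Icarr by (simp add: a_minus_def a_assoc r_neg)
      ultimately show ?thesis
        using quotient_eq_iff_same_a_r_cos[OF I.is_ideal, of "c \<odot> u'" "c \<odot> u"] i u I.Icarr
        by auto
    qed
    moreover have "u \<in> I +> u" using u by (rule I.a_rcos_self)
    ultimately have "\<Union>((\<lambda>u'. I +> (c \<odot> u')) ` (I +> u)) = I +> (c \<odot> u)"
      by (intro UN_constant_eq ballI)
    then show ?thesis unfolding quotient_algebra_def module.simps .
  qed
  have ring: "ring ?Q"
  proof (rule ringI)
    show "abelian_group ?Q"
    proof (rule abelian_groupI)
      show "\<exists>y\<in>carrier ?Q. y \<oplus>\<^bsub>?Q\<^esub> x = \<zero>\<^bsub>?Q\<^esub>" if "x \<in> carrier ?Q" for x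
        using that Q.l_neg[of x] Q.a_inv_closed[of x] by auto
    qed (simp_all add: Q.a_ac)
    show "Group.monoid ?Q"
      by (rule monoidI) (auto simp: Q.m_assoc)
  qed (auto simp: Q.l_distr Q.r_distr)
  have Q: "\<exists>u\<in>carrier R. U = I +> u" if "U \<in> carrier ?Q" for U
    using that by (simp add: carr)
  have "assoc_algebra ?Q"
  proof (intro assoc_algebra.intro assoc_algebra_axioms.intro ring)
    fix c d U V assume U: "U \<in> carrier ?Q" and V: "V \<in> carrier ?Q"
    obtain u v where [simp]: "U = I +> u" "V = I +> v" "u \<in> carrier R" "v \<in> carrier R"
      using Q[OF U] Q[OF V] by blast
    show "c \<odot>\<^bsub>?Q\<^esub> U \<in> carrier ?Q" by (auto simp: smult carr)
    show "(c + d) \<odot>\<^bsub>?Q\<^esub> U = c \<odot>\<^bsub>?Q\<^esub> U \<oplus>\<^bsub>?Q\<^esub> d \<odot>\<^bsub>?Q\<^esub> U"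
      by (simp add: smult hom smult_l_distr)
    show "c \<odot>\<^bsub>?Q\<^esub> (U \<oplus>\<^bsub>?Q\<^esub> V) = c \<odot>\<^bsub>?Q\<^esub> U \<oplus>\<^bsub>?Q\<^esub> c \<odot>\<^bsub>?Q\<^esub> V"
      by (simp add: smult hom smult_r_distr)
    show "(c * d) \<odot>\<^bsub>?Q\<^esub> U = c \<odot>\<^bsub>?Q\<^esub> (d \<odot>\<^bsub>?Q\<^esub> U)"
      by (simp add: smult smult_assoc1)
    show "1 \<odot>\<^bsub>?Q\<^esub> U = U"
      by (simp add: smult)
    show "(c \<odot>\<^bsub>?Q\<^esub> U) \<otimes>\<^bsub>?Q\<^esub> V = c \<odot>\<^bsub>?Q\<^esub> (U \<otimes>\<^bsub>?Q\<^esub> V)"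
      "U \<otimes>\<^bsub>?Q\<^esub> (c \<odot>\<^bsub>?Q\<^esub> V) = c \<odot>\<^bsub>?Q\<^esub> (U \<otimes>\<^bsub>?Q\<^esub> V)"
      by (simp_all add: smult hom smult_mult_left smult_mult_right)
  qed
  then show ?thesis
    using assoc_algebra_axioms smult I.rcos_ring_hom
    by (auto simp: assoc_algebra_hom_def assoc_algebra_hom_axioms_def ring_hom_def)
qed

lemma (in assoc_algebra) quotient_hom_eq_zero:
  assumes "ideal I R" "r \<in> I"
  shows "I +> r = \<zero>\<^bsub>quotient_algebra R I\<^esub>"
  using a_rcos_zero[OF assms] by (simp add: FactRing_def)

interpretation free: assoc_algebra "free_algebra :: ('k::field, 'g list \<Rightarrow>\<^sub>0 'k) module"
  unfolding free_algebra_def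
  by (rule assoc_algebra_monoid_algebra) (rule monoidI; simp)

lemma carrier_free_algebra [simp]: "carrier free_algebra = UNIV"
  by (simp add: free_algebra_def)

lemma presented_hom:
  "assoc_algebra_hom free_algebra (presented_algebra Rel) ((+>\<^bsub>free_algebra\<^esub>) (Idl\<^bsub>free_algebra\<^esub> Rel))"
  unfolding presented_algebra_def by (intro free.quotient_hom free.genideal_ideal) simp

lemma presented_relator:
  "r \<in> Rel \<Longrightarrow> (Idl\<^bsub>free_algebra\<^esub> Rel) +>\<^bsub>free_algebra\<^esub> r = \<zero>\<^bsub>presented_algebra Rel\<^esub>"
  unfolding presented_algebra_def
  using free.genideal_self[of Rel]
  by (intro free.quotient_hom_eq_zero free.genideal_ideal) auto

section \<open>The tensor product of two algebras\<close>

locale tensor_product = R: assoc_algebra R + S: assoc_algebra S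
  for R :: "('k::field, 'a, 'y) module_scheme" and S :: "('k, 'b, 'z) module_scheme"
begin

abbreviation "M \<equiv> monoid_algebra (R \<times>\<times> S) :: ('k, 'a \<times> 'b \<Rightarrow>\<^sub>0 'k) module"
abbreviation "I \<equiv> Idl\<^bsub>M\<^esub> (bilinear_relators R S)"
abbreviation "T \<equiv> tensor_algebra R S"
abbreviation "t \<equiv> pure_tensor R S"

sublocale M: assoc_algebra M
  by (intro assoc_algebra_monoid_algebra DirProd_monoid R.monoid_axioms S.monoid_axioms)

lemma relators_closed: "bilinear_relators R S \<subseteq> carrier M"
  unfolding bilinear_relators_def Let_def
  by (auto simp: in_keys_iff lookup_minus lookup_single when_def split: if_splits)

sublocale pi: assoc_algebra_hom M T "(+>\<^bsub>M\<^esub>) I"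
  unfolding tensor_algebra_def by (intro M.quotient_hom M.genideal_ideal relators_closed)

lemma pi_relator:
  assumes "r \<in> bilinear_relators R S"
  shows "I +>\<^bsub>M\<^esub> r = \<zero>\<^bsub>T\<^esub>"
  unfolding tensor_algebra_def
  using M.genideal_self[OF relators_closed] assms
  by (intro M.quotient_hom_eq_zero M.genideal_ideal relators_closed) auto

lemma pi_eq:
  assumes "f - g \<in> bilinear_relators R S" "g \<in> carrier M"
  shows "I +>\<^bsub>M\<^esub> f = I +>\<^bsub>M\<^esub> g"
proof -
  have "f - g \<in> carrier M" using assms(1) relators_closed by blast
  then have "I +>\<^bsub>M\<^esub> ((f - g) \<oplus>\<^bsub>M\<^esub> g) = (I +>\<^bsub>M\<^esub> (f - g)) \<oplus>\<^bsub>T\<^esub> (I +>\<^bsub>M\<^esub> g)"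
    using assms(2) by (rule pi.hom_add)
  then show ?thesis
    using pi_relator[OF assms(1)] pi.hom_closed[OF assms(2)] by simp
qed

lemma pure_tensor_closed [simp]:
  "\<lbrakk>a \<in> carrier R; b \<in> carrier S\<rbrakk> \<Longrightarrow> t a b \<in> carrier T"
  unfolding pure_tensor_def by (rule pi.hom_closed) auto

lemma pure_tensor_add_left:
  assumes "a \<in> carrier R" "a' \<in> carrier R" "b \<in> carrier S"
  shows "t (a \<oplus>\<^bsub>R\<^esub> a') b = t a b \<oplus>\<^bsub>T\<^esub> t a' b"
proof -
  let ?s = "\<lambda>a b. Poly_Mapping.single (a, b) 1 :: 'a \<times> 'b \<Rightarrow>\<^sub>0 'k"
  have "I +>\<^bsub>M\<^esub> (?s (a \<oplus>\<^bsub>R\<^esub> a') b) = I +>\<^bsub>M\<^esub> (?s a b \<oplus>\<^bsub>M\<^esub> ?s a' b)"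
  proof (rule pi_eq)
    have "?s (a \<oplus>\<^bsub>R\<^esub> a') b - (?s a b \<oplus>\<^bsub>M\<^esub> ?s a' b) = ?s (a \<oplus>\<^bsub>R\<^esub> a') b - ?s a b - ?s a' b" by simp
    also have "\<dots> \<in> bilinear_relators R S"
      unfolding bilinear_relators_def Let_def using assms by blast
    finally show "?s (a \<oplus>\<^bsub>R\<^esub> a') b - (?s a b \<oplus>\<^bsub>M\<^esub> ?s a' b) \<in> bilinear_relators R S" .
  qed (rule M.add.m_closed; use assms in simp)
  also have "\<dots> = (I +>\<^bsub>M\<^esub> ?s a b) \<oplus>\<^bsub>T\<^esub> (I +>\<^bsub>M\<^esub> ?s a' b)"
    by (rule pi.hom_add) (use assms in auto)
  finally show ?thesis by (simp add: pure_tensor_def)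
qed

lemma pure_tensor_add_right:
  assumes "a \<in> carrier R" "b \<in> carrier S" "b' \<in> carrier S"
  shows "t a (b \<oplus>\<^bsub>S\<^esub> b') = t a b \<oplus>\<^bsub>T\<^esub> t a b'"
proof -
  let ?s = "\<lambda>a b. Poly_Mapping.single (a, b) 1 :: 'a \<times> 'b \<Rightarrow>\<^sub>0 'k"
  have "I +>\<^bsub>M\<^esub> (?s a (b \<oplus>\<^bsub>S\<^esub> b')) = I +>\<^bsub>M\<^esub> (?s a b \<oplus>\<^bsub>M\<^esub> ?s a b')"
  proof (rule pi_eq)
    have "?s a (b \<oplus>\<^bsub>S\<^esub> b') - (?s a b \<oplus>\<^bsub>M\<^esub> ?s a b') = ?s a (b \<oplus>\<^bsub>S\<^esub> b') - ?s a b - ?s a b'" by simp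
    also have "\<dots> \<in> bilinear_relators R S"
      unfolding bilinear_relators_def Let_def using assms by blast
    finally show "?s a (b \<oplus>\<^bsub>S\<^esub> b') - (?s a b \<oplus>\<^bsub>M\<^esub> ?s a b') \<in> bilinear_relators R S" .
  qed (rule M.add.m_closed; use assms in simp)
  also have "\<dots> = (I +>\<^bsub>M\<^esub> ?s a b) \<oplus>\<^bsub>T\<^esub> (I +>\<^bsub>M\<^esub> ?s a b')"
    by (rule pi.hom_add) (use assms in auto)
  finally show ?thesis by (simp add: pure_tensor_def)
qed

lemma pure_tensor_smult:
  assumes "a \<in> carrier R" "b \<in> carrier S"
  shows "t (c \<odot>\<^bsub>R\<^esub> a) b = c \<odot>\<^bsub>T\<^esub> t a b" "t a (c \<odot>\<^bsub>S\<^esub> b) = c \<odot>\<^bsub>T\<^esub> t a b"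
proof -
  have "c \<odot>\<^bsub>T\<^esub> t a b = I +>\<^bsub>M\<^esub> Poly_Mapping.single (a, b) c"
    using assms pi.hom_smult[of "Poly_Mapping.single (a, b) 1" c] by (simp add: pure_tensor_def)
  moreover have "t (c \<odot>\<^bsub>R\<^esub> a) b = I +>\<^bsub>M\<^esub> Poly_Mapping.single (a, b) c"
    "t a (c \<odot>\<^bsub>S\<^esub> b) = I +>\<^bsub>M\<^esub> Poly_Mapping.single (a, b) c"
    unfolding pure_tensor_def
    by (rule pi_eq; use assms in \<open>auto simp: bilinear_relators_def Let_def\<close>)+
  ultimately show "t (c \<odot>\<^bsub>R\<^esub> a) b = c \<odot>\<^bsub>T\<^esub> t a b" "t a (c \<odot>\<^bsub>S\<^esub> b) = c \<odot>\<^bsub>T\<^esub> t a b"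
    by simp_all
qed

lemma pure_tensor_mult:
  assumes "a \<in> carrier R" "b \<in> carrier S" "a' \<in> carrier R" "b' \<in> carrier S"
  shows "t a b \<otimes>\<^bsub>T\<^esub> t a' b' = t (a \<otimes>\<^bsub>R\<^esub> a') (b \<otimes>\<^bsub>S\<^esub> b')"
  using assms pi.hom_mult[of "Poly_Mapping.single (a, b) 1" "Poly_Mapping.single (a', b') 1"]
  by (simp add: pure_tensor_def)

lemma pure_tensor_one: "t \<one>\<^bsub>R\<^esub> \<one>\<^bsub>S\<^esub> = \<one>\<^bsub>T\<^esub>"
  using pi.hom_one by (simp add: pure_tensor_def)

lemma tensor_hom_left: "assoc_algebra_hom R T (\<lambda>a. t a \<one>\<^bsub>S\<^esub>)"
  by unfold_locales
    (auto simp: pure_tensor_add_left pure_tensor_smult pure_tensor_mult pure_tensor_one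
      intro!: ring_hom_memI)

lemma tensor_hom_right: "assoc_algebra_hom S T (\<lambda>b. t \<one>\<^bsub>R\<^esub> b)"
  by unfold_locales
    (auto simp: pure_tensor_add_right pure_tensor_smult pure_tensor_mult pure_tensor_one
      intro!: ring_hom_memI)

text \<open>Both products are \<open>t a b\<close>, since the units are absorbed
  componentwise.\<close>

lemma tensor_commute:
  assumes "a \<in> carrier R" "b \<in> carrier S"
  shows "t \<one>\<^bsub>R\<^esub> b \<otimes>\<^bsub>T\<^esub> t a \<one>\<^bsub>S\<^esub> = t a \<one>\<^bsub>S\<^esub> \<otimes>\<^bsub>T\<^esub> t \<one>\<^bsub>R\<^esub> b"
  using assms by (simp add: pure_tensor_mult)

end

section \<open>Relations in the tensor product\<close>

context
  fixes \<epsilon> :: "'k::field"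
begin

interpretation A: assoc_algebra_hom free_algebra "A_alg :: ('k, ('n::finite xp_gen list \<Rightarrow>\<^sub>0 'k) set) module"
    "(+>\<^bsub>free_algebra\<^esub>) (Idl\<^bsub>free_algebra\<^esub> A_relators)"
  unfolding A_alg_def by (rule presented_hom)

interpretation C: assoc_algebra_hom free_algebra "C_alg \<epsilon> :: ('k, ('n::finite list \<Rightarrow>\<^sub>0 'k) set) module"
    "(+>\<^bsub>free_algebra\<^esub>) (Idl\<^bsub>free_algebra\<^esub> (C_relators \<epsilon>))"
  unfolding C_alg_def by (rule presented_hom)

interpretation AC: tensor_product "A_alg :: ('k, ('n::finite xp_gen list \<Rightarrow>\<^sub>0 'k) set) module"
    "C_alg \<epsilon> :: ('k, ('n list \<Rightarrow>\<^sub>0 'k) set) module" ..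

text \<open>Starting from the free algebra makes every defining relation accessible in the same way:
  its relator is sent to zero, and the homomorphism property translates this into an identity
  between the generators.\<close>

definition A_to_AC :: "('n::finite xp_gen list \<Rightarrow>\<^sub>0 'k) \<Rightarrow> ('k, 'n) AC" where
  "A_to_AC = (\<lambda>a. pure_tensor A_alg (C_alg \<epsilon>) a \<one>\<^bsub>C_alg \<epsilon>\<^esub>) \<circ>
    (+>\<^bsub>free_algebra\<^esub>) (Idl\<^bsub>free_algebra\<^esub> A_relators)"

definition C_to_AC :: "('n::finite list \<Rightarrow>\<^sub>0 'k) \<Rightarrow> ('k, 'n) AC" where
  "C_to_AC = pure_tensor A_alg (C_alg \<epsilon>) \<one>\<^bsub>A_alg\<^esub> \<circ>
    (+>\<^bsub>free_algebra\<^esub>) (Idl\<^bsub>free_algebra\<^esub> (C_relators \<epsilon>))"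

lemma A_to_AC_hom: "assoc_algebra_hom free_algebra (AC_alg \<epsilon>) A_to_AC"
  unfolding A_to_AC_def AC_alg_def
  by (rule assoc_algebra_hom_comp[OF A.assoc_algebra_hom_axioms AC.tensor_hom_left])

lemma C_to_AC_hom: "assoc_algebra_hom free_algebra (AC_alg \<epsilon>) C_to_AC"
  unfolding C_to_AC_def AC_alg_def
  by (rule assoc_algebra_hom_comp[OF C.assoc_algebra_hom_axioms AC.tensor_hom_right])

interpretation f: assoc_algebra_hom free_algebra "AC_alg \<epsilon>" A_to_AC by (rule A_to_AC_hom)
interpretation g: assoc_algebra_hom free_algebra "AC_alg \<epsilon>" C_to_AC by (rule C_to_AC_hom)

lemma A_to_AC_relator: "r \<in> A_relators \<Longrightarrow> A_to_AC r = \<zero>\<^bsub>AC_alg \<epsilon>\<^esub>"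
  by (simp add: A_to_AC_def A_alg_def[symmetric] presented_relator AC_alg_def
      ring_hom_zero[OF assoc_algebra_hom.hom[OF AC.tensor_hom_left] A.S.ring_axioms AC.pi.S.ring_axioms])

lemma C_to_AC_relator: "r \<in> C_relators \<epsilon> \<Longrightarrow> C_to_AC r = \<zero>\<^bsub>AC_alg \<epsilon>\<^esub>"
  by (simp add: C_to_AC_def C_alg_def[symmetric] presented_relator AC_alg_def
      ring_hom_zero[OF assoc_algebra_hom.hom[OF AC.tensor_hom_right] C.S.ring_axioms AC.pi.S.ring_axioms])

lemma AC_gens:
  "x_el \<epsilon> i = A_to_AC (free_gen (X i))" "p_el \<epsilon> i = A_to_AC (free_gen (P i))"
  "e_el \<epsilon> i = C_to_AC (free_gen i)"
  by (simp_all add: x_el_def p_el_def e_el_def A_to_AC_def C_to_AC_def presented_gen_def)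

lemma AC_assoc_algebra: "assoc_algebra (AC_alg \<epsilon>)"
  by (rule f.S.assoc_algebra_axioms)

lemma AC_gens_closed:
  "x_el \<epsilon> i \<in> carrier (AC_alg \<epsilon>)" "p_el \<epsilon> i \<in> carrier (AC_alg \<epsilon>)"
  "e_el \<epsilon> i \<in> carrier (AC_alg \<epsilon>)"
  by (simp_all add: AC_gens)

lemma e_commute:
  "e_el \<epsilon> i \<otimes>\<^bsub>AC_alg \<epsilon>\<^esub> x_el \<epsilon> j = x_el \<epsilon> j \<otimes>\<^bsub>AC_alg \<epsilon>\<^esub> e_el \<epsilon> i"
  "e_el \<epsilon> i \<otimes>\<^bsub>AC_alg \<epsilon>\<^esub> p_el \<epsilon> j = p_el \<epsilon> j \<otimes>\<^bsub>AC_alg \<epsilon>\<^esub> e_el \<epsilon> i"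
  by (simp_all add: AC_gens A_to_AC_def C_to_AC_def AC_alg_def AC.tensor_commute)

lemma A_relators_mem:
  fixes i j :: "'n::finite"
  defines "F \<equiv> free_algebra :: ('k, 'n xp_gen list \<Rightarrow>\<^sub>0 'k) module"
  shows "commutator F (free_gen (X i)) (free_gen (X j)) \<in> A_relators"
    "commutator F (free_gen (P i)) (free_gen (P j)) \<in> A_relators"
    "commutator F ((1/2) \<odot>\<^bsub>F\<^esub> (\<Oplus>\<^bsub>F\<^esub>k\<in>UNIV. free_gen (P k) \<otimes>\<^bsub>F\<^esub> free_gen (P k))) (free_gen (X j))
      \<ominus>\<^bsub>F\<^esub> free_gen (P j) \<in> A_relators"
  unfolding A_relators_def F_def Let_def by blast+

lemma commutator_eq_zero:
  "\<lbrakk>a \<in> carrier (AC_alg \<epsilon>); b \<in> carrier (AC_alg \<epsilon>)\<rbrakk> \<Longrightarrow> commutator (AC_alg \<epsilon>) a b = \<zero>\<^bsub>AC_alg \<epsilon>\<^esub> \<longleftrightarrow> a \<otimes>\<^bsub>AC_alg \<epsilon>\<^esub> b = b \<otimes>\<^bsub>AC_alg \<epsilon>\<^esub> a"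
  by (simp add: commutator_def f.S.minus_eq_zero)

lemma AC_commute:
  "x_el \<epsilon> i \<otimes>\<^bsub>AC_alg \<epsilon>\<^esub> x_el \<epsilon> j = x_el \<epsilon> j \<otimes>\<^bsub>AC_alg \<epsilon>\<^esub> x_el \<epsilon> i"
  "p_el \<epsilon> i \<otimes>\<^bsub>AC_alg \<epsilon>\<^esub> p_el \<epsilon> j = p_el \<epsilon> j \<otimes>\<^bsub>AC_alg \<epsilon>\<^esub> p_el \<epsilon> i"
  using A_to_AC_relator[OF A_relators_mem(1), of i j] A_to_AC_relator[OF A_relators_mem(2), of i j]
  by (simp_all add: AC_gens f.hom_commutator commutator_eq_zero f.S.ring_axioms)

lemma AC_hamiltonian:
  "commutator (AC_alg \<epsilon>) ((1/2) \<odot>\<^bsub>AC_alg \<epsilon>\<^esub> (\<Oplus>\<^bsub>AC_alg \<epsilon>\<^esub>k\<in>UNIV. p_el \<epsilon> k \<otimes>\<^bsub>AC_alg \<epsilon>\<^esub> p_el \<epsilon> k)) (x_el \<epsilon> j) = p_el \<epsilon> j"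
  using A_to_AC_relator[OF A_relators_mem(3), of j]
  by (simp add: AC_gens f.hom_commutator f.hom_minus f.hom_smult f.hom_finsum f.S.minus_eq_zero commutator_def o_def)

lemma AC_clifford:
  "anticommutator (AC_alg \<epsilon>) (e_el \<epsilon> i) (e_el \<epsilon> j) = (2 * \<epsilon> * of_bool (i = j)) \<odot>\<^bsub>AC_alg \<epsilon>\<^esub> \<one>\<^bsub>AC_alg \<epsilon>\<^esub>"
proof -
  let ?F = "free_algebra :: ('k, 'n::finite list \<Rightarrow>\<^sub>0 'k) module"
  have "anticommutator ?F (free_gen i) (free_gen j) \<ominus>\<^bsub>?F\<^esub> (2 * \<epsilon> * of_bool (i = j)) \<odot>\<^bsub>?F\<^esub> \<one>\<^bsub>?F\<^esub> \<in> C_relators \<epsilon>"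
    unfolding C_relators_def Let_def by blast
  from C_to_AC_relator[OF this] show ?thesis
    by (simp add: AC_gens g.hom_anticommutator g.hom_minus g.hom_smult f.S.minus_eq_zero anticommutator_def)
qed

end

section \<open>The commutation relation under ring-theoretic hypotheses\<close>

text \<open>
  \<open>eps\<close> and \<open>h\<close> play the roles of \<open>\<epsilon>\<close> and \<open>1/2\<close>; \<open>Q i\<close>, \<open>O2 i j\<close>, \<open>O3 i j k\<close> those of \<open>O\<^sub>i\<close>, \<open>O\<^sub>i\<^sub>j\<close>,
  \<open>O\<^sub>i\<^sub>j\<^sub>k\<close> for distinct indices. Of the commutators \<open>S\<close>, \<open>T\<close>, \<open>G\<close> only the symmetry matters: their
  contributions cancel by antisymmetry of \<open>L\<close>.
\<close>

locale symmetry_relations =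
  fixes x p e Q :: "'n \<Rightarrow> 'a::{ring,monoid_mult}" and C S T :: "'n \<Rightarrow> 'n \<Rightarrow> 'a"
    and G :: "'n \<Rightarrow> 'n \<Rightarrow> 'n \<Rightarrow> 'a" and eps h :: 'a
  assumes h: "h + h = 1" and epseps: "eps * eps = 1"
    and hc: "\<And>z. z * h = h * z" and epsc: "\<And>z. z * eps = eps * z"
    and xx: "\<And>i j. x i * x j = x j * x i"
    and pp: "\<And>i j. p i * p j = p j * p i"
    and ex: "\<And>i j. e i * x j = x j * e i"
    and ep: "\<And>i j. e i * p j = p j * e i"
    and ee: "\<And>i j. i \<noteq> j \<Longrightarrow> e i * e j = - (e j * e i)"
    and e2: "\<And>i. e i * e i = eps"
    and px: "\<And>i j. p i * x j = x j * p i + C i j"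
    and Cs: "\<And>i j. C i j = C j i"
    and eC: "\<And>i j k. e i * C j k = C j k * e i"
    and pC: "\<And>i j k. p i * C j k = C j k * p i + G i j k"
    and Gs: "\<And>i j k. G i j k = G j i k" "\<And>i j k. G i j k = G i k j"
    and eO: "\<And>i j. i \<noteq> j \<Longrightarrow> e i * Q j = C i j - Q j * e i"
    and eO2: "\<And>i. e i * Q i = C i i - 1 - Q i * e i"
    and Ss: "\<And>i j. S i j = S j i"
    and Ts: "\<And>i j. T i j = T j i"
    and Ox: "\<And>i j. Q i * x j = x j * Q i + S i j"
    and pO: "\<And>i j. p i * Q j = Q j * p i - T i j"
begin

definition "L i j = x i * p j - x j * p i"
definition "O2 i j = L i j + Q i * e j - Q j * e i + h * (eps * (e i * e j))"
definition "O3 i j k = Q i * (e j * e k) + Q j * (e k * e i) + Q k * (e i * e j)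
  + L i j * e k + L j k * e i + L k i * e j + eps * (e i * (e j * e k))"

text \<open>Products are kept associated to the right, so a rule for two letters also needs this
  version, which applies when further letters follow.\<close>

lemma mult_rewrite: "a * b = r \<Longrightarrow> a * (b * z) = r * z" for a b r z :: 'a
  by (metis mult.assoc)
lemma mult_lcommute: "a * b = b * a \<Longrightarrow> a * (b * z) = b * (a * z)" for a b z :: 'a
  by (metis mult.assoc)

lemmas normalize = ex ep px eC pC Ox pO
  ex[THEN mult_rewrite] ep[THEN mult_rewrite] px[THEN mult_rewrite] eC[THEN mult_rewrite]
  pC[THEN mult_rewrite] Ox[THEN mult_rewrite] pO[THEN mult_rewrite]

text \<open>Instances only, since \<open>z * h = h * z\<close> itself loops at \<open>z = h\<close>.\<close>

lemmas scalars_left = hc[of "x _"] hc[of "p _"] hc[of "e _"] hc[of "Q _"] hc[of "C _ _"]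
  hc[of "S _ _"] hc[of "T _ _"] hc[of "G _ _ _"] hc[of eps]
  epsc[of "x _"] epsc[of "p _"] epsc[of "e _"] epsc[of "Q _"] epsc[of "C _ _"]
  epsc[of "S _ _"] epsc[of "T _ _"] epsc[of "G _ _ _"]

lemmas distribs = distrib_left distrib_right left_diff_distrib right_diff_distrib

text \<open>Halves occur as products with the ring element \<open>h\<close>, which arithmetic on
  numerals does not merge; these rules do so, the second one inside a longer sum.\<close>

lemma half_add: "h * z + h * z = z" "h * z + (h * z + w) = z + w"
  by (metis h distrib_right mult_1_left add.assoc)+

lemma O2_commutator_disjoint:
  assumes d: "i \<noteq> j" "i \<noteq> k" "i \<noteq> l" "j \<noteq> k" "j \<noteq> l" "k \<noteq> l"
  shows "O2 i j * O2 k l - O2 k l * O2 i j = h * (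
    (Q i * O3 j k l + O3 j k l * Q i) - (Q j * O3 i k l + O3 i k l * Q j)
   - (Q k * O3 i j l + O3 i j l * Q k) + (Q l * O3 i j k + O3 i j k * Q l))"
proof -
  \<comment> \<open>Anticommutation in one direction only, so that rewriting sorts the Clifford
    generators into the order \<open>i\<close>, \<open>j\<close>, \<open>k\<close>, \<open>l\<close>
    and terminates.\<close>
  note ees = ee[of j i] ee[of k i] ee[of l i] ee[of k j] ee[of l j] ee[of l k]
  \<comment> \<open>The identity is proved doubled, which clears the factor \<open>h\<close> on the
    right.\<close>
  have "O2 i j * O2 k l - O2 k l * O2 i j + (O2 i j * O2 k l - O2 k l * O2 i j) =
    (Q i * O3 j k l + O3 j k l * Q i) - (Q j * O3 i k l + O3 i k l * Q j)
   - (Q k * O3 i j l + O3 i j l * Q k) + (Q l * O3 i j k + O3 i j k * Q l)"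
    unfolding O2_def O3_def L_def
    by (simp add: d d[symmetric] distribs mult.assoc normalize eO eO[THEN mult_rewrite]
        scalars_left scalars_left[THEN mult_rewrite] ees ees[THEN mult_rewrite]
        xx pp xx[THEN mult_lcommute] pp[THEN mult_lcommute] Cs Ss Ts Gs)
      (simp add: algebra_simps half_add)
  then show ?thesis using half_add(1) by (metis distrib_left)
qed

text \<open>The case \<open>k = j\<close> of the general formula. Two of its four anticommutators
  contain a symbol with a repeated index and vanish; the other two coincide, which cancels the
  factor one half. The new terms arise from \<open>e j * e j = eps\<close> and from the constant in
  \<open>eO2\<close>.\<close>

lemma O2_commutator_adjacent:
  assumes d: "i \<noteq> j" "i \<noteq> l" "j \<noteq> l"
  shows "O2 i j * O2 j l - O2 j l * O2 i j = O2 i l + eps * (Q i * Q l - Q l * Q i)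
   - (Q j * O3 i j l + O3 i j l * Q j)"
proof -
  note ees = ee[of j i] ee[of l i] ee[of l j]
  have e: "eps * (eps * z) = z" for z by (metis epseps mult.assoc mult_1_left)
  show ?thesis
    unfolding O2_def O3_def L_def
    by (simp add: d d[symmetric] distribs mult.assoc normalize eO eO[THEN mult_rewrite]
        eO2 eO2[THEN mult_rewrite] e2 e2[THEN mult_rewrite] e epseps
        scalars_left scalars_left[THEN mult_rewrite] ees ees[THEN mult_rewrite]
        xx pp xx[THEN mult_lcommute] pp[THEN mult_lcommute] Cs Ss Ts Gs)
      (simp add: algebra_simps half_add)
qed

end

section \<open>Deriving the hypotheses above from the defining relations\<close>

locale dunkl_clifford =
  fixes x p e :: "'n::finite \<Rightarrow> 'a::{ring,monoid_mult}" and eps h :: 'a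
  assumes half_unit: "h + h = 1" and eps_unit: "eps * eps = 1"
    and half_central: "\<And>z. z * h = h * z" and eps_central: "\<And>z. z * eps = eps * z"
    and x_commute: "\<And>i j. x i * x j = x j * x i"
    and p_commute: "\<And>i j. p i * p j = p j * p i"
    and e_x_commute: "\<And>i j. e i * x j = x j * e i"
    and e_p_commute: "\<And>i j. e i * p j = p j * e i"
    and hamiltonian: "\<And>j. h * (\<Sum>k\<in>UNIV. p k * p k) * x j - x j * (h * (\<Sum>k\<in>UNIV. p k * p k)) = p j"
    and clifford: "\<And>i j. e i * e j + e j * e i = (if i = j then eps + eps else 0)"
begin

definition "C i j = p i * x j - x j * p i"
definition "D = (\<Sum>k\<in>UNIV. e k * p k)"
text \<open>\<open>B j\<close> is the commutator of \<open>D\<close> with \<open>x j\<close> (see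
  \<open>D_x\<close>). In terms of it the one-index symmetry has the form \<open>Q j\<close>, free
  of \<open>D\<close>: for a one-entry list \<open>D\<close> enters only through this
  commutator.\<close>

definition "B j = (\<Sum>k\<in>UNIV. e k * C k j)"
definition "Q j = h * (eps * (B j - e j))"

lemma half: "h * z + h * z = z"
  by (metis half_unit distrib_right mult_1_left)

text \<open>With \<open>p i = [H, x i]\<close>, \<open>C i j\<close> is the double commutator
  \<open>[[H, x i], x j]\<close>, symmetric by the Jacobi identity because the \<open>x i\<close>
  commute.\<close>

lemma C_sym: "C i j = C j i"
proof -
  define H where "H = h * (\<Sum>k\<in>UNIV. p k * p k)"
  have p: "p j = H * x j - x j * H" for j using hamiltonian[of j] by (simp add: H_def)
  have "x i * (x j * H) = x j * (x i * H)" "H * (x i * x j) = H * (x j * x i)"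
    using x_commute by (metis mult.assoc)+
  then show ?thesis
    unfolding C_def p by (simp add: algebra_simps)
qed

lemma x_commute': "x i * (x j * z) = x j * (x i * z)" by (metis x_commute mult.assoc)
lemma p_commute': "p i * (p j * z) = p j * (p i * z)" by (metis p_commute mult.assoc)
lemma e_x_commute': "e i * (x j * z) = x j * (e i * z)" by (metis e_x_commute mult.assoc)
lemma e_p_commute': "e i * (p j * z) = p j * (e i * z)" by (metis e_p_commute mult.assoc)

lemma e_C_commute: "e i * C j k = C j k * e i"
  by (simp add: C_def right_diff_distrib left_diff_distrib mult.assoc
      e_x_commute e_p_commute e_x_commute' e_p_commute')

lemma e_C_commute': "e i * (C j k * z) = C j k * (e i * z)" by (metis e_C_commute mult.assoc)

text \<open>The Jacobi identity for \<open>C k i = [p k, x i]\<close> and commuting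
  \<open>x i\<close>, \<open>x j\<close>.\<close>

lemma Cx_sym: "C k i * x j - x j * C k i = C k j * x i - x i * C k j"
  unfolding C_def by (simp add: algebra_simps x_commute x_commute')

text \<open>By symmetry \<open>C k i\<close> is also \<open>[p i, x k]\<close>, and the Jacobi
  identity applies with commuting \<open>p i\<close>, \<open>p j\<close>.\<close>

lemma Cp_sym: "C k i * p j - p j * C k i = C k j * p i - p i * C k j"
  unfolding C_sym[of k] unfolding C_def by (simp add: algebra_simps p_commute p_commute')

lemma scalar_pull: "a * (h * z) = h * (a * z)" "a * (eps * z) = eps * (a * z)"
  by (metis half_central eps_central mult.assoc)+

lemmas scalars = scalar_pull[of "e _"] scalar_pull[of "x _"] scalar_pull[of "p _"]

lemma e_square: "e i * e i = eps"
  by (metis clifford half distrib_left)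

lemma D_x: "D * x j = x j * D + B j"
  unfolding D_def B_def C_def
  by (simp add: sum_distrib_left sum_distrib_right sum.distrib[symmetric] mult.assoc
      right_diff_distrib e_x_commute')

lemma sum_delta: "(\<Sum>k\<in>UNIV. (if k = j then z else 0) * f k) = z * f j" for f :: "'n \<Rightarrow> 'a"
proof -
  have "(\<Sum>k\<in>UNIV. (if k = j then z else 0) * f k) = (\<Sum>k\<in>UNIV. if k = j then z * f k else 0)"
    by (rule sum.cong) auto
  then show ?thesis by simp
qed

lemma D_e: "D * e j = - (e j * D) + (eps + eps) * p j"
proof -
  have "D * e j + e j * D = (\<Sum>k\<in>UNIV. (e k * e j + e j * e k) * p k)"
    unfolding D_def
    by (simp add: sum_distrib_left sum_distrib_right sum.distrib[symmetric] mult.assoc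
      distrib_right e_p_commute e_p_commute')
  then have "D * e j = (eps + eps) * p j - e j * D"
    by (simp only: clifford sum_delta eq_diff_eq)
  then show ?thesis by simp
qed

lemma e_B: "e i * B j + B j * e i = (eps + eps) * C i j"
proof -
  have "e i * B j + B j * e i = (\<Sum>k\<in>UNIV. (e k * e i + e i * e k) * C k j)"
    unfolding B_def
    by (simp add: sum_distrib_left sum_distrib_right sum.distrib[symmetric] mult.assoc
      distrib_right e_C_commute e_C_commute' add_ac)
  then show ?thesis by (simp add: clifford sum_delta)
qed

lemma eps_eps: "eps * (eps * z) = z"
  by (metis eps_unit mult.assoc mult_1_left)

lemma Q_e: "e i * Q j + Q j * e i = C i j - (if i = j then 1 else 0)"
proof -
  have "e i * Q j + Q j * e i = h * (eps * ((e i * B j + B j * e i) - (e i * e j + e j * e i)))"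
    by (simp add: Q_def scalars distrib_left right_diff_distrib left_diff_distrib mult.assoc)
  \<comment> \<open>Both anticommutators carry \<open>eps + eps\<close>; this doubled
    \<open>eps\<close> cancels against the prefactors \<open>h\<close> and \<open>eps\<close> of
    \<open>Q j\<close>.\<close>
  also have "(e i * B j + B j * e i) - (e i * e j + e j * e i) = eps * w + eps * w"
    if "w = C i j - (if i = j then 1 else 0)" for w
    by (simp add: that e_B clifford distrib_right right_diff_distrib)
  finally show ?thesis by (simp add: distrib_left eps_eps half)
qed

text \<open>The summand \<open>e i\<close> of \<open>B i - e i\<close> commutes with
  \<open>x j\<close>, so only the terms \<open>e k * C k i\<close> contribute, and for these the
  symmetry is \<open>Cx_sym\<close>.\<close>

lemma Q_x_sym: "Q i * x j - x j * Q i = Q j * x i - x i * Q j"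
proof -
  have "Q i * x j - x j * Q i = h * (eps * (\<Sum>k\<in>UNIV. e k * (C k i * x j - x j * C k i)))" for i j
    by (simp add: Q_def B_def scalars distrib_left right_diff_distrib left_diff_distrib
        sum_distrib_left sum_distrib_right mult.assoc e_x_commute e_x_commute' sum_subtractf)
  then show ?thesis by (simp only: Cx_sym[of _ i j])
qed

lemma Q_p_sym: "Q i * p j - p j * Q i = Q j * p i - p i * Q j"
proof -
  have "Q i * p j - p j * Q i = h * (eps * (\<Sum>k\<in>UNIV. e k * (C k i * p j - p j * C k i)))" for i j
    by (simp add: Q_def B_def scalars distrib_left right_diff_distrib left_diff_distrib
        sum_distrib_left sum_distrib_right mult.assoc e_p_commute e_p_commute' sum_subtractf)
  then show ?thesis by (simp only: Cp_sym[of _ i j])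
qed

text \<open>\<open>S\<close>, \<open>T\<close> and \<open>G\<close> are instantiated by the
  commutators themselves, so their exchange rules are trivial and only the symmetries carry
  content.\<close>

sublocale symmetry_relations x p e Q C "\<lambda>i j. Q i * x j - x j * Q i" "\<lambda>i j. Q j * p i - p i * Q j"
  "\<lambda>i j k. p i * C j k - C j k * p i" eps h
proof
  fix i j k
  show "e i * e j = - (e j * e i)" if "i \<noteq> j"
    using clifford[of i j] that by (simp add: eq_neg_iff_add_eq_0)
  show "p i * x j = x j * p i + C i j" by (simp add: C_def)
  show "p i * C j k - C j k * p i = p j * C i k - C i k * p j"
    using Cp_sym[of k i j] C_sym by (metis minus_diff_eq)
  show "p i * C j k - C j k * p i = p i * C k j - C k j * p i" by (simp add: C_sym)
  show "e i * Q j = C i j - Q j * e i" if "i \<noteq> j"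
    using Q_e[of i j] that by (simp add: eq_diff_eq)
  show "e i * Q i = C i i - 1 - Q i * e i"
    using Q_e[of i i] by (simp add: eq_diff_eq)
  show "Q j * p i - p i * Q j = Q i * p j - p j * Q i" by (rule Q_p_sym)
  show "C i j = C j i" by (rule C_sym)
  show "Q i * x j - x j * Q i = Q j * x i - x i * Q j" by (rule Q_x_sym)
  show "Q i * x j = x j * Q i + (Q i * x j - x j * Q i)" by simp
  show "p i * C j k = C j k * p i + (p i * C j k - C j k * p i)" by simp
  show "p i * Q j = Q j * p i - (Q j * p i - p i * Q j)" by simp
qed (rule half_unit eps_unit half_central eps_central x_commute p_commute e_x_commute e_p_commute
    e_square e_C_commute)+

text \<open>The definition of \<open>Q\<close> solved for \<open>B\<close>: commuting
  \<open>D\<close> past \<open>x j\<close> then yields letters known to the normal form.\<close>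

lemma B_Q: "B j = eps * Q j + eps * Q j + e j"
proof -
  have "eps * Q j = h * (B j - e j)"
    by (metis Q_def eps_eps scalar_pull(1))
  then show ?thesis by (simp add: half)
qed

section \<open>The elements \<open>O_A\<close> for lists of length one, two and three\<close>

definition "elist A = prod_list (map e A)"
definition "xlist A = (\<Sum>a\<in>set A. x a * e a)"
definition "Osym A =
  (if distinct A
   then h * (D * xlist A * elist A - elist A * xlist A * D - eps * elist A) else 0)"

text \<open>Moving \<open>D\<close> to the right in \<open>D * xlist A * elist A\<close> produces
  one term ending in \<open>D\<close>. It cancels against \<open>elist A * xlist A * D\<close>,
  since the signs from passing \<open>D\<close> and from reordering the Clifford generators agree.
  What remains are the terms with \<open>Q\<close>, \<open>p\<close> and \<open>eps\<close>.\<close>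

lemma Osym:
  "Osym [i] = Q i"
  "i \<noteq> j \<Longrightarrow> Osym [i, j] = O2 i j"
  "\<lbrakk>i \<noteq> j; i \<noteq> k; j \<noteq> k\<rbrakk> \<Longrightarrow> Osym [i, j, k] = O3 i j k"
proof -
  note scalars = hc[of "x _"] hc[of "p _"] hc[of "e _"] hc[of "Q _"] hc[of D] hc[of eps]
    epsc[of "x _"] epsc[of "p _"] epsc[of "e _"] epsc[of "Q _"] epsc[of D]
  note simps = Osym_def elist_def xlist_def distribs mult.assoc
    scalars scalars[THEN mult_rewrite] D_x D_x[THEN mult_rewrite] D_e D_e[THEN mult_rewrite]
    B_Q e2 e2[THEN mult_rewrite] ex ex[THEN mult_rewrite] ep ep[THEN mult_rewrite]
    epseps eps_eps half_add
  note ee' = ee[of j i] ee[of k i] ee[of k j]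
  note ee2 = ee' ee'[THEN mult_rewrite]
  show "Osym [i] = Q i"
    by (simp add: simps)
  show "Osym [i, j] = O2 i j" if "i \<noteq> j"
    using that by (simp add: simps ee2 O2_def L_def) (simp add: algebra_simps half_add)
  show "Osym [i, j, k] = O3 i j k" if "i \<noteq> j" "i \<noteq> k" "j \<noteq> k"
    using that by (simp add: simps ee2 O3_def L_def) (simp add: algebra_simps half_add)
qed

lemma O2_swap: "O2 j i = - O2 i j" if "i \<noteq> j"
  using ee[OF that] by (simp add: O2_def L_def)

lemma O3_swap:
  assumes "i \<noteq> j" "i \<noteq> k" "j \<noteq> k"
  shows "O3 j i k = - O3 i j k" "O3 i k j = - O3 i j k"
proof -
  note ee' = ee[of j i] ee[of k i] ee[of k j]
  show "O3 j i k = - O3 i j k" "O3 i k j = - O3 i j k"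
    using assms by (simp_all add: O3_def L_def ee' ee'[THEN mult_rewrite] left_diff_distrib mult.assoc)
qed

lemma Osym_not_distinct: "\<not> distinct A \<Longrightarrow> Osym A = 0"
  by (simp add: Osym_def)

lemma Osym_swap: "Osym [j, i] = - Osym [i, j]" "Osym [j, i, k] = - Osym [i, j, k]"
   "Osym [i, k, j] = - Osym [i, j, k]"
proof -
  show "Osym [j, i] = - Osym [i, j]"
    by (cases "i = j") (simp_all add: Osym_not_distinct Osym O2_swap[of i j])
  show "Osym [j, i, k] = - Osym [i, j, k]" "Osym [i, k, j] = - Osym [i, j, k]"
    by (cases "distinct [i, j, k]"; fastforce simp: Osym_not_distinct Osym O3_swap[of i j k])+
qed

section \<open>The commutation relation for all index patterns\<close>

definition "comm a b = a * b - b * (a::'a)"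
definition "anti a b = a * b + b * (a::'a)"

lemma comm_simps: "comm (- a) b = - comm a b" "comm a (- b) = - comm a b" "comm a a = 0"
    "comm 0 a = 0" "comm a 0 = 0"
  and anti_simps: "anti (- a) b = - anti a b" "anti a (- b) = - anti a b" "anti 0 a = 0" "anti a 0 = 0"
  by (simp_all add: comm_def anti_def)

lemma comm_swap: "comm a b = - comm b a"
  by (simp add: comm_def)

lemma anti_swap: "anti a b = anti b a"
  by (simp add: anti_def add.commute)

lemma comm_Osym_adjacent:
  assumes "i \<noteq> j" "i \<noteq> l" "j \<noteq> l"
  shows "comm (Osym [i, j]) (Osym [j, l]) =
    Osym [i, l] + eps * comm (Osym [i]) (Osym [l]) - anti (Osym [j]) (Osym [i, j, l])"
  using assms O2_commutator_adjacent[of i j l] by (simp add: comm_def anti_def Osym)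

theorem comm_Osym:
  "comm (Osym [i, j]) (Osym [k, l]) =
     (if j = k then Osym [i, l] + eps * comm (Osym [i]) (Osym [l]) else 0)
   + (if i = l then Osym [j, k] + eps * comm (Osym [j]) (Osym [k]) else 0)
   + (if l = j then Osym [k, i] + eps * comm (Osym [k]) (Osym [i]) else 0)
   + (if k = i then Osym [l, j] + eps * comm (Osym [l]) (Osym [j]) else 0)
   + h * (anti (Osym [i]) (Osym [j, k, l]) - anti (Osym [j]) (Osym [i, k, l])
        - anti (Osym [i, j, l]) (Osym [k]) + anti (Osym [i, j, k]) (Osym [l]))"
proof -
  define A where "A a b = Osym [a, b] + eps * comm (Osym [a]) (Osym [b])" for a b
  \<comment> \<open>The defect of the identity. It is antisymmetric in \<open>i\<close>,
    \<open>j\<close> and in \<open>k\<close>, \<open>l\<close>, which reduces the patterns with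
    coinciding indices to a few.\<close>
  define f where "f i j k l = comm (Osym [i, j]) (Osym [k, l]) -
    ((if j = k then A i l else 0) + (if i = l then A j k else 0)
   + (if l = j then A k i else 0) + (if k = i then A l j else 0)
   + h * (anti (Osym [i]) (Osym [j, k, l]) - anti (Osym [j]) (Osym [i, k, l])
        - anti (Osym [i, j, l]) (Osym [k]) + anti (Osym [i, j, k]) (Osym [l])))" for i j k l
  have A_swap: "A b a = - A a b" for a b
    by (simp add: A_def Osym_swap(1)[of b a] comm_swap[of "Osym [b]"])
  have swap: "f j i k l = - f i j k l" "f i j l k = - f i j k l" for i j k l
  proof -
    \<comment> \<open>Swapping \<open>i\<close> and \<open>j\<close> exchanges, up to sign, the term
      for \<open>j = k\<close> with that for \<open>k = i\<close> and the term for
      \<open>i = l\<close> with that for \<open>l = j\<close>; swapping \<open>k\<close> and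
      \<open>l\<close> pairs them similarly. The rules in \<open>s\<close> orient the equations and
      the arguments of \<open>A\<close> so that these terms match.\<close>
    have if_minus: "(if P then - z else 0) = - (if P then z else 0)" for P and z :: 'a
      by simp
    note s = A_swap[of j l] A_swap[of i k] A_swap[of k j] A_swap[of l i]
      eq_commute[of i k] eq_commute[of j l] eq_commute[of l i] eq_commute[of k j]
      if_minus comm_simps anti_simps
    show "f j i k l = - f i j k l"
      unfolding f_def Osym_swap(1)[of j i] Osym_swap(2)[of j i] s
      by (simp add: algebra_simps split del: if_split)
    show "f i j l k = - f i j k l"
      unfolding f_def Osym_swap(1)[of l k] Osym_swap(3)[of _ l k] s
      by (simp add: algebra_simps split del: if_split)
  qed
  have null: "f i j k l = 0" if "i = j \<or> k = l" for i j k l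
  proof -
    \<comment> \<open>A swap of two equal indices changes nothing, so the defect equals its
      negative; multiplying by \<open>h\<close> removes the factor two.\<close>
    have "f i j k l = - f i j k l" using that swap[of i j k l] by metis
    then have "h * (f i j k l + f i j k l) = 0"
      by (metis ab_group_add_class.ab_left_minus mult_zero_right)
    then show ?thesis by (simp add: distrib_left half)
  qed
  have meet: "f i j j l = 0" if "i \<noteq> j" "j \<noteq> l" for i j l
  proof (cases "i = l")
    \<comment> \<open>Every term vanishes: \<open>Osym [i, j]\<close> commutes with its negative,
      the symbols \<open>A i i\<close> and \<open>A j j\<close> are zero, and each three-index list
      repeats an entry.\<close>
    case True
    with that show ?thesis
      by (simp add: f_def A_def Osym_swap(1)[of l j] Osym_not_distinct comm_simps anti_simps)
  next
    case False
    with that half[of "anti (Osym [j]) (Osym [i, j, l])"] show ?thesis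
      by (simp add: f_def A_def comm_Osym_adjacent Osym_not_distinct anti_simps
          anti_swap[of _ "Osym [j]"] right_diff_distrib)
        (metis minus_add_distrib diff_conv_add_uminus)
  qed
  have "f i j k l = 0"
  proof (cases "distinct [i, j, k, l]")
    case True
    then have d: "i \<noteq> j" "i \<noteq> k" "i \<noteq> l" "j \<noteq> k" "j \<noteq> l" "k \<noteq> l"
      by auto
    then show ?thesis using O2_commutator_disjoint[OF d]
      by (simp add: f_def d[symmetric] Osym comm_def anti_def add.commute)
  next
    case False
    then consider "i = j \<or> k = l" | "i \<noteq> j" "k \<noteq> l" "j = k" | "i \<noteq> j" "k \<noteq> l" "i = k"
      | "i \<noteq> j" "k \<noteq> l" "j = l" | "i \<noteq> j" "k \<noteq> l" "i = l"
      by auto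
    then show ?thesis
    \<comment> \<open>In the last four cases swaps bring the shared index into the two middle
      positions, where \<open>meet\<close> applies.\<close>
    proof cases
      case 1
      then show ?thesis by (rule null)
    next
      case 2
      then show ?thesis using meet[of i j l] by simp
    next
      case 3
      then show ?thesis using meet[of j i l] swap(1)[of i j k l] by simp
    next
      case 4
      then show ?thesis using meet[of i j k] swap(2)[of i j k l] by simp
    next
      case 5
      then show ?thesis using meet[of j i k] swap(1)[of i j k l] swap(2)[of j i k l] by simp
    qed
  qed
  then show ?thesis by (simp only: f_def A_def right_minus_eq)
qed

end

section \<open>Transfer to the tensor product\<close>

interpretation AC: assoc_algebra "AC_alg \<epsilon>" for \<epsilon>
  by (rule AC_assoc_algebra)

definition sign :: "bool \<Rightarrow> 'k::field" where
  "sign b = (if b then 1 else - 1)"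

text \<open>A type cannot depend on the value \<epsilon>, so its elements are pairs with one
  component for each sign.\<close>

typedef (overloaded) ('k, 'n) ac =
  "{f :: bool \<Rightarrow> ('k::field, 'n::finite) AC. \<forall>b. f b \<in> carrier (AC_alg (sign b))}"
  by (rule exI[of _ "\<lambda>b. \<zero>\<^bsub>AC_alg (sign b)\<^esub>"]) simp

setup_lifting type_definition_ac

lemma Rep_ac_closed [simp]: "Rep_ac a b \<in> carrier (AC_alg (sign b))"
  using Rep_ac[of a] by simp

lemma ac_eqI: "(\<And>b. Rep_ac a b = Rep_ac a' b) \<Longrightarrow> a = a'"
  by (simp add: Rep_ac_inject[symmetric] fun_eq_iff)

instantiation ac :: (field, finite) "{ring, monoid_mult}"
begin

lift_definition zero_ac :: "('a, 'b) ac" is "\<lambda>b. \<zero>\<^bsub>AC_alg (sign b)\<^esub>" by simp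
lift_definition one_ac :: "('a, 'b) ac" is "\<lambda>b. \<one>\<^bsub>AC_alg (sign b)\<^esub>" by simp
lift_definition uminus_ac :: "('a, 'b) ac \<Rightarrow> ('a, 'b) ac"
  is "\<lambda>f b. \<ominus>\<^bsub>AC_alg (sign b)\<^esub> f b" by simp
lift_definition plus_ac :: "('a, 'b) ac \<Rightarrow> ('a, 'b) ac \<Rightarrow> ('a, 'b) ac"
  is "\<lambda>f g b. f b \<oplus>\<^bsub>AC_alg (sign b)\<^esub> g b" by simp
lift_definition minus_ac :: "('a, 'b) ac \<Rightarrow> ('a, 'b) ac \<Rightarrow> ('a, 'b) ac"
  is "\<lambda>f g b. f b \<ominus>\<^bsub>AC_alg (sign b)\<^esub> g b" by simp
lift_definition times_ac :: "('a, 'b) ac \<Rightarrow> ('a, 'b) ac \<Rightarrow> ('a, 'b) ac"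
  is "\<lambda>f g b. f b \<otimes>\<^bsub>AC_alg (sign b)\<^esub> g b" by simp

lemmas Rep_ac_simps = zero_ac.rep_eq one_ac.rep_eq uminus_ac.rep_eq plus_ac.rep_eq
  minus_ac.rep_eq times_ac.rep_eq

instance
  by intro_classes
    (rule ac_eqI, simp add: Rep_ac_simps AC.m_assoc AC.a_ac AC.l_distr AC.r_distr AC.r_neg
      a_minus_def)+

end

lift_definition x_ac :: "'n::finite \<Rightarrow> ('k::field, 'n) ac" is "\<lambda>i b. x_el (sign b) i"
  by (simp add: AC_gens_closed)
lift_definition p_ac :: "'n::finite \<Rightarrow> ('k::field, 'n) ac" is "\<lambda>i b. p_el (sign b) i"
  by (simp add: AC_gens_closed)
lift_definition e_ac :: "'n::finite \<Rightarrow> ('k::field, 'n) ac" is "\<lambda>i b. e_el (sign b) i"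
  by (simp add: AC_gens_closed)
text \<open>The scalar may differ between the components: \<open>sign\<close> gives the element
  \<open>eps\<close>, a constant family gives one half.\<close>

lift_definition scalar_ac :: "(bool \<Rightarrow> 'k) \<Rightarrow> ('k::field, 'n::finite) ac"
  is "\<lambda>c b. c b \<odot>\<^bsub>AC_alg (sign b)\<^esub> \<one>\<^bsub>AC_alg (sign b)\<^esub>" by simp

lemmas Rep_ac_gens = x_ac.rep_eq p_ac.rep_eq e_ac.rep_eq

lemma Rep_scalar_mult: "Rep_ac (scalar_ac c * a) b = c b \<odot>\<^bsub>AC_alg (sign b)\<^esub> Rep_ac a b"
  by (simp add: times_ac.rep_eq scalar_ac.rep_eq AC.smult_mult_left)

lemma Rep_mult_scalar: "Rep_ac (a * scalar_ac c) b = c b \<odot>\<^bsub>AC_alg (sign b)\<^esub> Rep_ac a b"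
  by (simp add: times_ac.rep_eq scalar_ac.rep_eq AC.smult_mult_right)

lemma Rep_ac_sum:
  "finite A \<Longrightarrow> Rep_ac (sum f A) b = (\<Oplus>\<^bsub>AC_alg (sign b)\<^esub>a\<in>A. Rep_ac (f a) b)"
  by (induction A rule: finite_induct) (simp_all add: Rep_ac_simps Pi_def)

text \<open>The class provides a bijection compatible with sums and products. Its value at 1 is a
  nonzero idempotent of a field, hence 1, so 2 is mapped to a nonzero number.\<close>

lemma two_neq_zero: "(2 :: 'k::real_or_complex) \<noteq> 0"
proof -
  have "h 2 \<noteq> h (0::'k)" if "bij h" "\<And>a b. h (a + b) = h a + h b" "\<And>a b. h (a * b) = h a * h b"
    for h :: "'k \<Rightarrow> 'c::field_char_0"
  proof -
    have h0: "h 0 = 0" using that(2)[of 0 0] by simp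
    have "h 1 \<noteq> h 0" using that(1) by (metis bij_pointE zero_neq_one)
    moreover have "h 1 * h 1 = h 1" using that(3)[of 1 1] by simp
    ultimately have "h 1 = 1" using h0 by simp
    then show ?thesis using h0 that(2)[of 1 1] by simp
  qed
  then show ?thesis using real_or_complex[where 'a = 'k] by metis
qed

interpretation ac: dunkl_clifford "x_ac :: 'n::finite \<Rightarrow> ('k::real_or_complex, 'n) ac" p_ac e_ac
  "scalar_ac sign" "scalar_ac (\<lambda>_. 1/2)"
proof
  let ?h = "scalar_ac (\<lambda>_. 1/2) :: ('k, 'n) ac" and ?eps = "scalar_ac sign :: ('k, 'n) ac"
  have half: "1/2 + 1/2 = (1::'k)"
    using two_neq_zero[where 'k = 'k] by (simp add: field_simps)
  have sign: "sign b * sign b = (1::'k)" for b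
    by (simp add: sign_def)
  show "?h + ?h = 1"
    by (rule ac_eqI) (simp add: Rep_ac_simps scalar_ac.rep_eq AC.smult_l_distr[symmetric] half)
  show "?eps * ?eps = 1"
    by (rule ac_eqI)
      (simp add: Rep_scalar_mult scalar_ac.rep_eq AC.smult_assoc1[symmetric] sign one_ac.rep_eq)
  show "z * ?h = ?h * z" "z * ?eps = ?eps * z" for z
    by (rule ac_eqI, simp add: Rep_scalar_mult Rep_mult_scalar)+
  fix i j :: 'n
  show "x_ac i * x_ac j = x_ac j * (x_ac i :: ('k, 'n) ac)"
    "p_ac i * p_ac j = p_ac j * (p_ac i :: ('k, 'n) ac)"
    "e_ac i * x_ac j = x_ac j * (e_ac i :: ('k, 'n) ac)"
    "e_ac i * p_ac j = p_ac j * (e_ac i :: ('k, 'n) ac)"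
    by (rule ac_eqI, simp add: Rep_ac_simps Rep_ac_gens AC_commute e_commute)+
  \<comment> \<open>Products are unfolded only for selected left factors, so that the product with
    \<open>?h\<close> is left to \<open>Rep_scalar_mult\<close> and becomes a scaling.\<close>
  show "?h * (\<Sum>k\<in>UNIV. p_ac k * p_ac k) * x_ac j
      - x_ac j * (?h * (\<Sum>k\<in>UNIV. p_ac k * p_ac k)) = p_ac j"
    by (rule ac_eqI)
      (simp add: minus_ac.rep_eq times_ac.rep_eq[of "_ * _"] times_ac.rep_eq[of "x_ac _"]
        times_ac.rep_eq[of "p_ac _"] Rep_scalar_mult Rep_ac_sum Rep_ac_gens AC_hamiltonian[unfolded commutator_def])
  show "e_ac i * e_ac j + e_ac j * e_ac i = (if i = j then ?eps + ?eps else 0)"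
  proof (rule ac_eqI)
    fix b
    have "Rep_ac (e_ac i * e_ac j + e_ac j * e_ac i :: ('k, 'n) ac) b =
      anticommutator (AC_alg (sign b)) (e_el (sign b) i) (e_el (sign b) j)"
      by (simp add: anticommutator_def Rep_ac_simps Rep_ac_gens)
    also have "\<dots> = Rep_ac (if i = j then ?eps + ?eps else 0) b"
      unfolding AC_clifford
      by (cases "i = j")
        (simp_all add: zero_ac.rep_eq plus_ac.rep_eq scalar_ac.rep_eq flip: AC.smult_l_distr)
    finally show "Rep_ac (e_ac i * e_ac j + e_ac j * e_ac i :: ('k, 'n) ac) b =
      Rep_ac (if i = j then ?eps + ?eps else 0) b" .
  qed
qed

lemma Rep_Osym: "Rep_ac (ac.Osym A) b = O_el (sign b) A"
proof -
  have D: "Rep_ac ac.D b = D_el (sign b)"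
    by (simp add: ac.D_def D_el_def Rep_ac_sum Rep_ac_simps Rep_ac_gens)
  have e: "Rep_ac (ac.elist A) b = e_list (sign b) A"
    by (induction A) (simp_all add: ac.elist_def e_list_def Rep_ac_simps Rep_ac_gens)
  have x: "Rep_ac (ac.xlist A) b = x_list (sign b) A"
    by (simp add: ac.xlist_def x_list_def Rep_ac_sum Rep_ac_simps Rep_ac_gens)
  \<comment> \<open>The factors \<open>h\<close> and \<open>eps\<close> must become scalings before
    the remaining products are unfolded, hence two rounds of simplification.\<close>
  show ?thesis
    unfolding ac.Osym_def O_el_def Let_def
    by (simp add: Rep_scalar_mult minus_ac.rep_eq zero_ac.rep_eq)
      (simp add: times_ac.rep_eq D e x)
qed

lemma Rep_comm: "Rep_ac (ac.comm a a') b = commutator (AC_alg (sign b)) (Rep_ac a b) (Rep_ac a' b)"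
  by (simp add: ac.comm_def commutator_def Rep_ac_simps)

lemma Rep_anti: "Rep_ac (ac.anti a a') b = anticommutator (AC_alg (sign b)) (Rep_ac a b) (Rep_ac a' b)"
  by (simp add: ac.anti_def anticommutator_def Rep_ac_simps)

lemma Rep_if: "Rep_ac (if Q then a else 0) b = of_bool Q \<odot>\<^bsub>AC_alg (sign b)\<^esub> Rep_ac a b"
  by (simp add: Rep_ac_simps)

theorem theorem3p12:
  fixes \<epsilon> :: "'k::real_or_complex"
    and i j k l :: "'n::finite"
    and T (structure)
  assumes \<epsilon>: "\<epsilon> = 1 \<or> \<epsilon> = -1"
    and T: "T = AC_alg \<epsilon>"
  shows
    "commutator T (O_el \<epsilon> [i, j]) (O_el \<epsilon> [k, l]) =
       of_bool (j = k) \<odot> (O_el \<epsilon> [i, l] \<oplus> \<epsilon> \<odot> commutator T (O_el \<epsilon> [i]) (O_el \<epsilon> [l]))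
     \<oplus> of_bool (i = l) \<odot> (O_el \<epsilon> [j, k] \<oplus> \<epsilon> \<odot> commutator T (O_el \<epsilon> [j]) (O_el \<epsilon> [k]))
     \<oplus> of_bool (l = j) \<odot> (O_el \<epsilon> [k, i] \<oplus> \<epsilon> \<odot> commutator T (O_el \<epsilon> [k]) (O_el \<epsilon> [i]))
     \<oplus> of_bool (k = i) \<odot> (O_el \<epsilon> [l, j] \<oplus> \<epsilon> \<odot> commutator T (O_el \<epsilon> [l]) (O_el \<epsilon> [j]))
     \<oplus> (1/2) \<odot> (anticommutator T (O_el \<epsilon> [i]) (O_el \<epsilon> [j, k, l])
               \<ominus> anticommutator T (O_el \<epsilon> [j]) (O_el \<epsilon> [i, k, l])
               \<ominus> anticommutator T (O_el \<epsilon> [i, j, l]) (O_el \<epsilon> [k])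
               \<oplus> anticommutator T (O_el \<epsilon> [i, j, k]) (O_el \<epsilon> [l]))"
proof -
  define b where "b \<longleftrightarrow> \<epsilon> = 1"
  have b: "\<epsilon> = sign b"
    using \<epsilon> by (auto simp: sign_def b_def)
  show ?thesis
    \<comment> \<open>The component at \<open>b\<close> of the identity in the product is the claim
      for the given \<epsilon>.\<close>
    using arg_cong[OF ac.comm_Osym[of i j k l], where f = "\<lambda>a :: ('k, 'n) ac. Rep_ac a b"]
    unfolding T b
      plus_ac.rep_eq minus_ac.rep_eq Rep_if Rep_scalar_mult Rep_comm Rep_anti Rep_Osym .
qed

end
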